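(* Let $n \geq 1$ be an integer. The matrix group $(\mathcal{Z}_2^n, \cdot)$ is isomorphic to $((\mathbb{Z}/2\mathbb{Z})^n, +)$ and acts by conjugation on $M_{2^n}(\mathbb{R})$. Let $\mathrm{Fix}(\mathcal{Z}_2^n) \subset M_{2^n}(\mathbb{R})$ be the set of fixed points of this action. Then: (1) $\mathrm{Fix}(\mathcal{Z}_2^n) = \mathbb{A}_{2^n}$. (2) $\mathrm{Fix}(\mathcal{Z}_2^n)$ is characterized by its eigenvalue decomposition: a matrix $C \in M_{2^n}(\mathbb{R})$ lies in $\mathrm{Fix}(\mathcal{Z}_2^n)$ if and only if $C = V D V^{-1}$ for some real diagonal matrix $D$, where $V = \begin{pmatrix} 1 & 1 \\ 1 & -1 \end{pmatrix}^{\otimes n}$. (3) For every $A \in \mathrm{Fix}(\mathcal{Z}_2^n) \cap GL_{2^n}(\mathbb{R})$, the lattice $\Lambda = A \cdot \mathbb{Z}^{2^n}$ has at least $2^n - 1$ distinct symmetries.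
   Context: $\otimes$ denotes the Kronecker product of matrices, and $M^{\otimes k}$ the $k$-fold Kronecker product of $M$ with itself (with $M^{\otimes 0} = (1)$). Let $J_2 = \begin{pmatrix} 0 & 1 \\ 1 & 0 \end{pmatrix}$. For $k \in \{1,\dots,n\}$ let $J_{2^n}^{k} = J_2^{\otimes k} \otimes \mathrm{Id}_2^{\otimes (n-k)} \in M_{2^n}(\mathbb{R})$ (here $k$ is an upper index, not a power). The group $\mathcal{Z}_2^n$ is the multiplicative group of matrices generated by $J_{2^n}^1,\dots,J_{2^n}^n$; equivalently, it consists of all $M_1 \otimes \cdots \otimes M_n$ with each $M_i \in \{\mathrm{Id}_2, J_2\}$. It acts on $M_{2^n}(\mathbb{R})$ by conjugation, and its set of fixed points is $\mathrm{Fix}(\mathcal{Z}_2^n) = \{A \in M_{2^n}(\mathbb{R}) \mid J_{2^n}^k A J_{2^n}^k = A \text{ for all } k \in \{1,\dots,n\}\}$ (each $J_{2^n}^k$ is its own inverse). The sets $\mathbb{A}_{2^n} \subset M_{2^n}(\mathbb{R})$ are defined inductively by $\mathbb{A}_2 = \left\{ \begin{pmatrix} a & b \\ b & a \end{pmatrix} \mid a,b \in \mathbb{R} \right\}$ and $\mathbb{A}_{2^{m+1}} = \left\{ \begin{pmatrix} A & B \\ B & A \end{pmatrix} \mid A, B \in \mathbb{A}_{2^m} \right\}$ for $m \geq 1$. A symmetry of a lattice $\Lambda \subset \mathbb{R}^d$ is an orthogonal matrix $O \in O_d(\mathbb{R}) \setminus \{\pm \mathrm{Id}_d\}$ with $O\Lambda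 = \Lambda$. *)

theory Defs
  imports "Jordan_Normal_Form.Matrix" "HOL-Algebra.Algebra"
begin

section \<open>Kronecker products\<close>

definition kron :: "'a::semiring_1 mat \<Rightarrow> 'a mat \<Rightarrow> 'a mat" (infixl \<open>\<otimes>\<^sub>K\<close> 70) where
  "A \<otimes>\<^sub>K B = mat (dim_row A * dim_row B) (dim_col A * dim_col B)
     (\<lambda>(i, j). A $$ (i div dim_row B, j div dim_col B) * B $$ (i mod dim_row B, j mod dim_col B))"

primrec kron_pow :: "'a::semiring_1 mat \<Rightarrow> nat \<Rightarrow> 'a mat" where
  "kron_pow M 0 = 1\<^sub>m 1"
| "kron_pow M (Suc k) = M \<otimes>\<^sub>K kron_pow M k"

section \<open>The matrix group and its action by conjugation\<close>

definition GL :: "nat \<Rightarrow> real mat monoid" where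
  "GL d = units_of (ring_mat TYPE(real) d ())"

definition J2 :: "real mat" where
  "J2 = mat_of_rows_list 2 [[0, 1], [1, 0]]"

definition J :: "nat \<Rightarrow> nat \<Rightarrow> real mat" where
  "J n k = kron_pow J2 k \<otimes>\<^sub>K kron_pow (1\<^sub>m 2) (n - k)"

text \<open>The constant \<open>subgroup_generated\<close> only takes the generators that lie in the
  ambient group into account; \<open>J_in_GL\<close> below shows that none is lost here.\<close>

definition Z2_group :: "nat \<Rightarrow> real mat monoid" where
  "Z2_group n = subgroup_generated (GL (2 ^ n)) (J n ` {1..n})"

text \<open>The restriction makes each conjugation an extensional function, as the library's
  \<open>BijGroup\<close>, and hence \<open>group_action\<close>, requires.\<close>

definition conj_action :: "nat \<Rightarrow> real mat \<Rightarrow> real mat \<Rightarrow> real mat" where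
  "conj_action d g = (\<lambda>A \<in> carrier_mat d d. g * A * inv\<^bsub>GL d\<^esub> g)"

definition fixed_points :: "('g, 'm) monoid_scheme \<Rightarrow> 'x set \<Rightarrow> ('g \<Rightarrow> 'x \<Rightarrow> 'x) \<Rightarrow> 'x set" where
  "fixed_points G E \<phi> = {x \<in> E. \<forall>g \<in> carrier G. \<phi> g x = x}"

definition Fix_Z2 :: "nat \<Rightarrow> real mat set" where
  "Fix_Z2 n = fixed_points (Z2_group n) (carrier_mat (2 ^ n) (2 ^ n)) (conj_action (2 ^ n))"

section \<open>The recursively defined matrix sets\<close>

text \<open>\<open>AA m\<close> is the set of matrices of size \<open>2 ^ m\<close>. The recursion starts at \<open>m = 1\<close>;
  the value at \<open>0\<close> is a mere convention.\<close>

fun AA :: "nat \<Rightarrow> real mat set" where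
  "AA 0 = carrier_mat 1 1"
| "AA (Suc 0) = {mat_of_rows_list 2 [[a, b], [b, a]] | a b. True}"
| "AA (Suc (Suc m)) = {four_block_mat A B B A | A B. A \<in> AA (Suc m) \<and> B \<in> AA (Suc m)}"

section \<open>The matrix of eigenvectors\<close>

definition V :: "nat \<Rightarrow> real mat" where
  "V n = kron_pow (mat_of_rows_list 2 [[1, 1], [1, -1]]) n"

section \<open>Lattices and their symmetries\<close>

definition lattice_of :: "nat \<Rightarrow> real mat \<Rightarrow> real vec set" where
  "lattice_of d A = (\<lambda>z. A *\<^sub>v z) ` {z \<in> carrier_vec d. \<forall>i < d. z $ i \<in> \<int>}"

text \<open>Orthogonality is spelled out, as \<open>orthogonal_mat\<close> of the library does not
  require the columns to have norm one.\<close>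

definition symmetries :: "nat \<Rightarrow> real vec set \<Rightarrow> real mat set" where
  "symmetries d \<Lambda> = {Q \<in> carrier_mat d d. transpose_mat Q * Q = 1\<^sub>m d
     \<and> Q \<noteq> 1\<^sub>m d \<and> Q \<noteq> - 1\<^sub>m d \<and> (\<lambda>x. Q *\<^sub>v x) ` \<Lambda> = \<Lambda>}"

section \<open>Well-formedness of the definitions\<close>

lemma dim_kron [simp]:
  "dim_row (A \<otimes>\<^sub>K B) = dim_row A * dim_row B" "dim_col (A \<otimes>\<^sub>K B) = dim_col A * dim_col B"
  by (simp_all add: kron_def)

lemma sum_div_mod:
  fixes f :: "nat \<Rightarrow> nat \<Rightarrow> 'a::comm_monoid_add"
  shows "(\<Sum>k<m * d. f (k div d) (k mod d)) = (\<Sum>a<m. \<Sum>b<d. f a b)"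
proof -
  have "(\<Sum>k<m * d. f (k div d) (k mod d)) = (\<Sum>a<m. \<Sum>k\<in>{a * d..<a * d + d}. f (k div d) (k mod d))"
    by (rule sum.nat_group [symmetric])
  also have "\<dots> = (\<Sum>a<m. \<Sum>b<d. f a b)"
  proof (rule sum.cong [OF refl])
    fix a
    have "(\<Sum>k\<in>{a * d..<a * d + d}. f (k div d) (k mod d))
      = (\<Sum>b<d. f ((b + a * d) div d) ((b + a * d) mod d))"
      using sum.shift_bounds_nat_ivl [of "\<lambda>k. f (k div d) (k mod d)" 0 "a * d" d]
      by (simp add: atLeast0LessThan add.commute)
    then show "(\<Sum>k\<in>{a * d..<a * d + d}. f (k div d) (k mod d)) = (\<Sum>b<d. f a b)"
      by simp
  qed
  finally show ?thesis .
qed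

lemma kron_mult:
  fixes A B C D :: "'a::comm_semiring_1 mat"
  assumes "dim_col A = dim_row C" "dim_col B = dim_row D"
  shows "(A \<otimes>\<^sub>K B) * (C \<otimes>\<^sub>K D) = (A * C) \<otimes>\<^sub>K (B * D)"
proof (rule eq_matI)
  fix i j
  assume "i < dim_row ((A * C) \<otimes>\<^sub>K (B * D))" "j < dim_col ((A * C) \<otimes>\<^sub>K (B * D))"
  then have i: "i < dim_row A * dim_row B" and j: "j < dim_col C * dim_col D" by auto
  then have pos: "dim_row B > 0" "dim_col D > 0" by (auto intro: gr0I)
  have bounds: "i div dim_row B < dim_row A" "j div dim_col D < dim_col C"
    using i j by (auto simp: less_mult_imp_div_less)
  have "((A \<otimes>\<^sub>K B) * (C \<otimes>\<^sub>K D)) $$ (i, j)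
    = (\<Sum>k<dim_row C * dim_row D.
        (A $$ (i div dim_row B, k div dim_row D) * B $$ (i mod dim_row B, k mod dim_row D)) *
        (C $$ (k div dim_row D, j div dim_col D) * D $$ (k mod dim_row D, j mod dim_col D)))"
    using i j assms by (simp add: kron_def scalar_prod_def atLeast0LessThan)
  also have "\<dots> = (\<Sum>a<dim_row C. \<Sum>b<dim_row D.
        (A $$ (i div dim_row B, a) * B $$ (i mod dim_row B, b)) *
        (C $$ (a, j div dim_col D) * D $$ (b, j mod dim_col D)))"
    by (rule sum_div_mod)
  also have "\<dots> = (\<Sum>a<dim_row C. A $$ (i div dim_row B, a) * C $$ (a, j div dim_col D)) *
      (\<Sum>b<dim_row D. B $$ (i mod dim_row B, b) * D $$ (b, j mod dim_col D))"
    by (simp add: sum_product mult_ac)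
  also have "\<dots> = ((A * C) \<otimes>\<^sub>K (B * D)) $$ (i, j)"
    using i j assms pos bounds by (simp add: kron_def scalar_prod_def atLeast0LessThan)
  finally show "((A \<otimes>\<^sub>K B) * (C \<otimes>\<^sub>K D)) $$ (i, j) = ((A * C) \<otimes>\<^sub>K (B * D)) $$ (i, j)" .
qed auto

lemma kron_one: "1\<^sub>m a \<otimes>\<^sub>K 1\<^sub>m b = (1\<^sub>m (a * b) :: 'a::semiring_1 mat)"
proof (rule eq_matI)
  fix i j assume "i < dim_row (1\<^sub>m (a * b) :: 'a mat)" "j < dim_col (1\<^sub>m (a * b) :: 'a mat)"
  then have ij: "i < a * b" "j < a * b" by auto
  then have "b > 0" by (auto intro: gr0I)
  moreover have "i = j \<longleftrightarrow> i div b = j div b \<and> i mod b = j mod b"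
    by (metis div_mult_mod_eq)
  ultimately show "(1\<^sub>m a \<otimes>\<^sub>K 1\<^sub>m b) $$ (i, j) = (1\<^sub>m (a * b) :: 'a mat) $$ (i, j)"
    using ij by (auto simp: kron_def less_mult_imp_div_less)
qed auto

lemma kron_smult:
  fixes A B :: "'a::comm_semiring_1 mat"
  shows "(c \<cdot>\<^sub>m A) \<otimes>\<^sub>K (d \<cdot>\<^sub>m B) = (c * d) \<cdot>\<^sub>m (A \<otimes>\<^sub>K B)"
proof (rule eq_matI)
  fix i j assume "i < dim_row ((c * d) \<cdot>\<^sub>m (A \<otimes>\<^sub>K B))" "j < dim_col ((c * d) \<cdot>\<^sub>m (A \<otimes>\<^sub>K B))"
  then have i: "i < dim_row A * dim_row B" and j: "j < dim_col A * dim_col B" by auto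
  then have "dim_row B > 0" "dim_col B > 0" by (auto intro: gr0I)
  then show "((c \<cdot>\<^sub>m A) \<otimes>\<^sub>K (d \<cdot>\<^sub>m B)) $$ (i, j) = ((c * d) \<cdot>\<^sub>m (A \<otimes>\<^sub>K B)) $$ (i, j)"
    using i j by (simp add: kron_def less_mult_imp_div_less mult_ac)
qed auto

lemma kron_pow_carrier:
  "M \<in> carrier_mat d d \<Longrightarrow> kron_pow M k \<in> carrier_mat (d ^ k) (d ^ k)"
proof (induction k)
  case (Suc k)
  show ?case
    using carrier_matD [OF Suc.prems] carrier_matD [OF Suc.IH [OF Suc.prems]]
    by (intro carrier_matI) simp_all
qed simp

lemma kron_pow_square:
  fixes M :: "'a::comm_semiring_1 mat"
  assumes M: "M \<in> carrier_mat d d" and sq: "M * M = c \<cdot>\<^sub>m 1\<^sub>m d"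
  shows "kron_pow M k * kron_pow M k = c ^ k \<cdot>\<^sub>m 1\<^sub>m (d ^ k)"
proof (induction k)
  case (Suc k)
  have "kron_pow M (Suc k) * kron_pow M (Suc k) = (M * M) \<otimes>\<^sub>K (kron_pow M k * kron_pow M k)"
    using M kron_pow_carrier [OF M, of k] by (simp add: kron_mult)
  then show ?case by (simp add: Suc sq kron_smult kron_one)
qed auto

lemma pow2_split: "k \<le> n \<Longrightarrow> 2 ^ k * 2 ^ (n - k) = (2 ^ n :: nat)"
  by (metis le_add_diff_inverse power_add)

lemma J2_square: "J2 \<in> carrier_mat 2 2" "J2 * J2 = 1 \<cdot>\<^sub>m 1\<^sub>m 2"
proof -
  show J2: "J2 \<in> carrier_mat 2 2"
    by (rule carrier_matI) (simp_all add: J2_def mat_of_rows_list_def)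
  show "J2 * J2 = 1 \<cdot>\<^sub>m 1\<^sub>m 2"
    by (rule eq_matI) (auto simp: J2_def mat_of_rows_list_def scalar_prod_def numeral_2_eq_2
        less_Suc_eq)
qed

lemma J_carrier:
  assumes "k \<le> n" shows "J n k \<in> carrier_mat (2 ^ n) (2 ^ n)"
proof -
  have "dim_row (kron_pow J2 k) = 2 ^ k" "dim_col (kron_pow J2 k) = 2 ^ k"
    using kron_pow_carrier [OF J2_square(1), of k] by auto
  moreover have "dim_row (kron_pow (1\<^sub>m 2 :: real mat) (n - k)) = 2 ^ (n - k)"
    "dim_col (kron_pow (1\<^sub>m 2 :: real mat) (n - k)) = 2 ^ (n - k)"
    using kron_pow_carrier [OF one_carrier_mat, of 2 "n - k"] by auto
  ultimately show ?thesis
    unfolding J_def using pow2_split [OF assms] by (intro carrier_matI) simp_all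
qed

lemma J_square:
  assumes "k \<le> n" shows "J n k * J n k = 1\<^sub>m (2 ^ n)"
proof -
  let ?I = "1\<^sub>m 2 :: real mat"
  have I2: "?I \<in> carrier_mat 2 2" "?I * ?I = 1 \<cdot>\<^sub>m 1\<^sub>m 2"
    by auto
  have one: "1 \<cdot>\<^sub>m A = A" for A :: "real mat"
    by (rule eq_matI) auto
  have "J n k * J n k = (kron_pow J2 k * kron_pow J2 k) \<otimes>\<^sub>K (kron_pow ?I (n - k) * kron_pow ?I (n - k))"
    unfolding J_def
    using kron_pow_carrier [OF J2_square(1), of k] kron_pow_carrier [OF I2(1), of "n - k"]
    by (intro kron_mult) auto
  also have "\<dots> = 1\<^sub>m (2 ^ k) \<otimes>\<^sub>K 1\<^sub>m (2 ^ (n - k))"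
    by (simp only: kron_pow_square [OF J2_square] kron_pow_square [OF I2] power_one one)
  also have "\<dots> = 1\<^sub>m (2 ^ n)"
    by (simp only: kron_one pow2_split [OF assms])
  finally show ?thesis .
qed

lemma carrier_GL: "carrier (GL d) = {A \<in> carrier_mat d d. \<exists>B \<in> carrier_mat d d. B * A = 1\<^sub>m d \<and> A * B = 1\<^sub>m d}"
  by (auto simp: GL_def units_of_def Units_def ring_mat_def)

lemma mult_GL: "x \<otimes>\<^bsub>GL d\<^esub> y = x * y" and one_GL: "\<one>\<^bsub>GL d\<^esub> = 1\<^sub>m d"
  by (simp_all add: GL_def units_of_def ring_mat_def)

lemma group_GL: "group (GL d)"
  unfolding GL_def
  by (rule monoid.units_group, rule ring.is_monoid) (rule ring_mat)

lemma J_in_GL: "k \<le> n \<Longrightarrow> J n k \<in> carrier (GL (2 ^ n))"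
  unfolding carrier_GL using J_carrier J_square by blast

lemma inv_J: "k \<le> n \<Longrightarrow> inv\<^bsub>GL (2 ^ n)\<^esub> J n k = J n k"
  using group.inv_equality [OF group_GL, where x = "J n k" and y = "J n k"] J_in_GL J_square
  by (simp add: mult_GL one_GL)

lemma V_in_GL: "V n \<in> carrier (GL (2 ^ n))"
proof -
  let ?W = "mat_of_rows_list 2 [[1, 1], [1, -1]] :: real mat"
  have W: "?W \<in> carrier_mat 2 2" "?W * ?W = 2 \<cdot>\<^sub>m 1\<^sub>m 2"
    by (rule carrier_matI, simp_all add: mat_of_rows_list_def)
      (rule eq_matI, auto simp: mat_of_rows_list_def scalar_prod_def numeral_2_eq_2 less_Suc_eq)
  have C: "V n \<in> carrier_mat (2 ^ n) (2 ^ n)" and VV: "V n * V n = 2 ^ n \<cdot>\<^sub>m 1\<^sub>m (2 ^ n)"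
    using kron_pow_carrier [OF W(1)] kron_pow_square [OF W] by (simp_all add: V_def)
  have "(1 / 2 ^ n) \<cdot>\<^sub>m (2 ^ n \<cdot>\<^sub>m 1\<^sub>m (2 ^ n)) = (1\<^sub>m (2 ^ n) :: real mat)"
    by (rule eq_matI) auto
  then have "((1 / 2 ^ n) \<cdot>\<^sub>m V n) * V n = 1\<^sub>m (2 ^ n)" "V n * ((1 / 2 ^ n) \<cdot>\<^sub>m V n) = 1\<^sub>m (2 ^ n)"
    using C VV mult_smult_assoc_mat [OF C C] mult_smult_distrib [OF C C] by simp_all
  moreover have "(1 / 2 ^ n) \<cdot>\<^sub>m V n \<in> carrier_mat (2 ^ n) (2 ^ n)"
    using C by simp
  ultimately show ?thesis
    unfolding carrier_GL using C by blast
qed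

lemma Fix_Z2_eq:
  "Fix_Z2 n = {A \<in> carrier_mat (2 ^ n) (2 ^ n). \<forall>k \<in> {1..n}. J n k * A * J n k = A}"
proof -
  let ?N = "2 ^ n :: nat"
  let ?G = "GL ?N"
  interpret G: group ?G by (rule group_GL)
  have sub: "J n ` {1..n} \<subseteq> carrier ?G" using J_in_GL by auto
  have carr: "carrier (Z2_group n) = generate ?G (J n ` {1..n})"
    using sub by (simp add: Z2_group_def carrier_subgroup_generated Int_absorb1)
  have gen: "g * A * inv\<^bsub>?G\<^esub> g = A"
    if A: "A \<in> carrier_mat ?N ?N" and fixA: "\<And>k. k \<in> {1..n} \<Longrightarrow> J n k * A * J n k = A"
      and g: "g \<in> generate ?G (J n ` {1..n})" for A g
    using g
  proof induction
    case one
    then show ?case using A by (simp only: G.inv_one) (simp add: one_GL)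
  next
    case (incl h)
    then show ?case using fixA inv_J by auto
  next
    case (inv h)
    then show ?case using fixA inv_J by auto
  next
    case (eng g h)
    have gh: "g \<in> carrier ?G" "h \<in> carrier ?G"
      using eng.hyps G.generate_in_carrier [OF sub] by auto
    have c: "g \<in> carrier_mat ?N ?N" "h \<in> carrier_mat ?N ?N"
      "inv\<^bsub>?G\<^esub> g \<in> carrier_mat ?N ?N" "inv\<^bsub>?G\<^esub> h \<in> carrier_mat ?N ?N"
      using gh G.inv_closed [OF gh(1)] G.inv_closed [OF gh(2)] by (auto simp: carrier_GL)
    have "inv\<^bsub>?G\<^esub> (g * h) = inv\<^bsub>?G\<^esub> h * inv\<^bsub>?G\<^esub> g"
      using G.inv_mult_group [OF gh] by (simp add: mult_GL)
    then have "g * h * A * inv\<^bsub>?G\<^esub> (g * h) = g * (h * A * inv\<^bsub>?G\<^esub> h) * inv\<^bsub>?G\<^esub> g"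
      using A c by (simp add: assoc_mult_mat [of _ ?N ?N _ ?N _ ?N])
    then show ?case using eng.IH by (simp add: mult_GL)
  qed
  show ?thesis
  proof (intro equalityI subsetI)
    fix A assume "A \<in> Fix_Z2 n"
    then have A: "A \<in> carrier_mat ?N ?N"
      and fixA: "\<And>g. g \<in> generate ?G (J n ` {1..n}) \<Longrightarrow> g * A * inv\<^bsub>?G\<^esub> g = A"
      by (auto simp: Fix_Z2_def fixed_points_def conj_action_def carr)
    have "J n k * A * J n k = A" if "k \<in> {1..n}" for k
      using fixA [OF generate.incl, OF imageI, OF that] that inv_J [of k n] by simp
    with A show "A \<in> {A \<in> carrier_mat ?N ?N. \<forall>k \<in> {1..n}. J n k * A * J n k = A}" by auto
  next
    fix A assume "A \<in> {A \<in> carrier_mat ?N ?N. \<forall>k \<in> {1..n}. J n k * A * J n k = A}"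
    then show "A \<in> Fix_Z2 n"
      using gen by (auto simp: Fix_Z2_def fixed_points_def conj_action_def carr)
  qed
qed

end

theory Submission
  imports Defs
begin

text \<open>
  Tensoring a \<open>2 \<times> 2\<close> matrix from the left with \<open>Y\<close> produces a \<open>2 \<times> 2\<close> block matrix whose blocks are
  multiples of \<open>Y\<close> (\<open>kron_2x2_four_block\<close>). As \<open>J (n + 1) (k + 1) = J2 \<otimes> J n k\<close>, with
  \<open>J n 0\<close> the identity, and \<open>V (n + 1) = W \<otimes> V n\<close> for the \<open>2 \<times> 2\<close> matrix \<open>W\<close> with rows
  \<open>(1, 1)\<close> and \<open>(1, -1)\<close>, every part of the theorem becomes an induction on the number \<open>n\<close> of
  tensor factors, read off from blocks.

  \<^item> Fixed points (\<open>Fix_Z2_Suc\<close>). Conjugation by \<open>J2 \<otimes> Y\<close> swaps the two block rows and the two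
    block columns and conjugates each block by \<open>Y\<close>. For \<open>Y = J n 0\<close> this forces the shape with
    diagonal blocks \<open>A\<close> and off-diagonal blocks \<open>B\<close>; given this shape, the other generators say
    precisely that \<open>A\<close> and \<open>B\<close> are fixed points for \<open>n\<close>. This is the recursion that defines
    \<open>AA\<close>.

  \<^item> Eigenvectors (\<open>diagonalized_Suc\<close>). Because \<open>V n\<close> squares to \<open>2 ^ n\<close>, the matrices
    \<open>V D V\<inverse>\<close> are the matrices \<open>V D V\<close>. For \<open>D\<close> with diagonal blocks \<open>E\<close> and \<open>F\<close>, the blocks of
    \<open>V D V\<close> are \<open>V n (E + F) V n\<close> on the diagonal and \<open>V n (E - F) V n\<close> off it, and \<open>E + F\<close> and
    \<open>E - F\<close> are an arbitrary pair of diagonal matrices. So this family obeys the same recursion.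

  \<^item> The group (\<open>carrier_Z2_group\<close>, \<open>flip_mat_iso\<close>). The product of two consecutive generators is
    \<open>J2\<close> in a single tensor factor, so the group consists of all tensor products of
    identities and copies of \<open>J2\<close>. Recording the parity of the exponent of \<open>J2\<close> in
    each factor gives the isomorphism with \<open>n\<close> copies of the integers modulo 2.

  \<^item> Symmetries (\<open>flip_mat_symmetry\<close>). A group element \<open>P\<close> is symmetric with square 1 and has
    entries 0 and 1, so it is orthogonal, differs from \<open>-1\<close> and permutes the integer vectors. It
    commutes with every fixed point \<open>A\<close>, hence \<open>P A \<int>\<^sup>d = A P \<int>\<^sup>d = A \<int>\<^sup>d\<close> for
    \<open>d = 2 ^ n\<close>. All \<open>2 ^ n - 1\<close> group elements other than 1 are therefore symmetries of the
    lattice.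
\<close>

section \<open>Kronecker products and block matrices\<close>

lemma kron_assoc:
  fixes A B C :: "'a::semiring_1 mat"
  shows "(A \<otimes>\<^sub>K B) \<otimes>\<^sub>K C = A \<otimes>\<^sub>K (B \<otimes>\<^sub>K C)"
proof (rule eq_matI)
  fix i j assume "i < dim_row (A \<otimes>\<^sub>K (B \<otimes>\<^sub>K C))" "j < dim_col (A \<otimes>\<^sub>K (B \<otimes>\<^sub>K C))"
  then have ij: "i < dim_row A * dim_row B * dim_row C" "j < dim_col A * dim_col B * dim_col C"
    by (simp_all add: mult.assoc)
  then have pos: "dim_row B > 0" "dim_row C > 0" "dim_col B > 0" "dim_col C > 0"
    by (auto intro: gr0I)
  have "i div dim_row C < dim_row A * dim_row B" "j div dim_col C < dim_col A * dim_col B"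
    using ij by (simp_all add: less_mult_imp_div_less)
  moreover have "i div (dim_row B * dim_row C) < dim_row A" "j div (dim_col B * dim_col C) < dim_col A"
    using ij by (simp_all add: less_mult_imp_div_less mult.assoc)
  moreover have "i mod (dim_row B * dim_row C) < dim_row B * dim_row C"
    "j mod (dim_col B * dim_col C) < dim_col B * dim_col C"
    using pos by simp_all
  moreover have "a mod (b * c) div c = a div c mod b" "a mod (b * c) mod c = a mod c"
    "a div (b * c) = a div c div b" if "c > 0" for a b c :: nat
    using that mod_mult2_eq [of a c b] div_mult2_eq [of a c b] by (simp_all add: mult.commute)
  ultimately show "((A \<otimes>\<^sub>K B) \<otimes>\<^sub>K C) $$ (i, j) = (A \<otimes>\<^sub>K (B \<otimes>\<^sub>K C)) $$ (i, j)"
    using ij pos by (simp add: kron_def mult.assoc)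
qed (simp_all add: mult.assoc)

lemma kron_transpose: "transpose_mat (A \<otimes>\<^sub>K B) = transpose_mat A \<otimes>\<^sub>K transpose_mat B"
proof (rule eq_matI)
  fix i j
  assume "i < dim_row (transpose_mat A \<otimes>\<^sub>K transpose_mat B)"
    "j < dim_col (transpose_mat A \<otimes>\<^sub>K transpose_mat B)"
  then have ij: "i < dim_col A * dim_col B" "j < dim_row A * dim_row B" by auto
  then have "dim_row B > 0" "dim_col B > 0" by (auto intro: gr0I)
  with ij show "transpose_mat (A \<otimes>\<^sub>K B) $$ (i, j) = (transpose_mat A \<otimes>\<^sub>K transpose_mat B) $$ (i, j)"
    by (simp add: kron_def less_mult_imp_div_less)
qed auto

lemma kron_2x2_four_block:
  fixes M U :: "'a::semiring_1 mat"
  assumes M: "M \<in> carrier_mat 2 2" and U: "U \<in> carrier_mat r c"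
  shows "M \<otimes>\<^sub>K U = four_block_mat (M $$ (0, 0) \<cdot>\<^sub>m U) (M $$ (0, 1) \<cdot>\<^sub>m U)
    (M $$ (1, 0) \<cdot>\<^sub>m U) (M $$ (1, 1) \<cdot>\<^sub>m U)"
proof (rule eq_matI)
  let ?B = "four_block_mat (M $$ (0, 0) \<cdot>\<^sub>m U) (M $$ (0, 1) \<cdot>\<^sub>m U)
    (M $$ (1, 0) \<cdot>\<^sub>m U) (M $$ (1, 1) \<cdot>\<^sub>m U)"
  fix i j assume "i < dim_row ?B" "j < dim_col ?B"
  then have ij: "i < r + r" "j < c + c" using U by auto
  have split: "a div d = (if a < d then 0 else 1) \<and> a mod d = (if a < d then a else a - d)"
    if "a < d + d" for a d :: nat
    using that by (auto simp: div_if mod_if)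
  show "(M \<otimes>\<^sub>K U) $$ (i, j) = ?B $$ (i, j)"
    using ij U M split [OF ij(1)] split [OF ij(2)] by (auto simp: kron_def)
qed (use M U in auto)

lemma one_smult_mat [simp]: "(1 :: 'a::monoid_mult) \<cdot>\<^sub>m A = A"
  by (rule eq_matI) auto

lemma zero_smult_mat: "A \<in> carrier_mat r c \<Longrightarrow> (0 :: 'a::mult_zero) \<cdot>\<^sub>m A = 0\<^sub>m r c"
  by (rule eq_matI) auto

lemma J2_index: "J2 $$ (0, 0) = 0" "J2 $$ (0, 1) = 1" "J2 $$ (1, 0) = 1" "J2 $$ (1, 1) = 0"
  by (simp_all add: J2_def mat_of_rows_list_def)

lemma kron_J2: "U \<in> carrier_mat d d \<Longrightarrow> J2 \<otimes>\<^sub>K U = four_block_mat (0\<^sub>m d d) U U (0\<^sub>m d d)"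
  by (simp add: kron_2x2_four_block [OF J2_square(1)] J2_index [simplified] zero_smult_mat)

lemma kron_id2:
  "U \<in> carrier_mat d d \<Longrightarrow> 1\<^sub>m 2 \<otimes>\<^sub>K U = four_block_mat U (0\<^sub>m d d) (0\<^sub>m d d) U"
  by (simp add: kron_2x2_four_block [OF one_carrier_mat] zero_smult_mat)

lemma four_block_mat_inject:
  assumes "A \<in> carrier_mat d d" "B \<in> carrier_mat d d" "C \<in> carrier_mat d d" "D \<in> carrier_mat d d"
    and "A' \<in> carrier_mat d d" "B' \<in> carrier_mat d d" "C' \<in> carrier_mat d d" "D' \<in> carrier_mat d d"
  shows "four_block_mat A B C D = four_block_mat A' B' C' D'
    \<longleftrightarrow> A = A' \<and> B = B' \<and> C = C' \<and> D = D'"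
proof
  let ?L = "four_block_mat A B C D" and ?R = "four_block_mat A' B' C' D'"
  assume eq: "?L = ?R"
  have ix: "?L $$ (i, j) = ?R $$ (i, j)" for i j by (simp add: eq)
  show "A = A' \<and> B = B' \<and> C = C' \<and> D = D'"
  proof (intro conjI eq_matI)
    fix i j assume "i < dim_row A'" "j < dim_col A'"
    then show "A $$ (i, j) = A' $$ (i, j)" using ix [of i j] assms by auto
  next
    fix i j assume "i < dim_row B'" "j < dim_col B'"
    then show "B $$ (i, j) = B' $$ (i, j)" using ix [of i "j + d"] assms by auto
  next
    fix i j assume "i < dim_row C'" "j < dim_col C'"
    then show "C $$ (i, j) = C' $$ (i, j)" using ix [of "i + d" j] assms by auto
  next
    fix i j assume "i < dim_row D'" "j < dim_col D'"
    then show "D $$ (i, j) = D' $$ (i, j)" using ix [of "i + d" "j + d"] assms by auto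
  qed (use assms in auto)
qed auto

lemma obtain_four_blocks:
  assumes "A \<in> carrier_mat (2 * d) (2 * d)"
  obtains P Q R S where "P \<in> carrier_mat d d" "Q \<in> carrier_mat d d" "R \<in> carrier_mat d d"
    "S \<in> carrier_mat d d" "A = four_block_mat P Q R S"
proof -
  obtain P Q R S where "split_block A d d = (P, Q, R, S)" by (metis prod_cases4)
  from split_block [OF this, of d d] assms show ?thesis by (intro that) auto
qed

lemma diagonal_four_block:
  assumes "A \<in> carrier_mat d d" "B \<in> carrier_mat d d" "C \<in> carrier_mat d d" "D \<in> carrier_mat d d"
  shows "diagonal_mat (four_block_mat A B C D)
    \<longleftrightarrow> diagonal_mat A \<and> B = 0\<^sub>m d d \<and> C = 0\<^sub>m d d \<and> diagonal_mat D"
proof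
  assume diag: "diagonal_mat (four_block_mat A B C D)"
  have ix: "four_block_mat A B C D $$ (i, j) = 0" if "i < d + d" "j < d + d" "i \<noteq> j" for i j
    using diag that assms unfolding diagonal_mat_def by auto
  show "diagonal_mat A \<and> B = 0\<^sub>m d d \<and> C = 0\<^sub>m d d \<and> diagonal_mat D"
    unfolding diagonal_mat_def
  proof (intro conjI allI impI eq_matI)
    fix i j assume "i < dim_row A" "j < dim_col A" "i \<noteq> j"
    then show "A $$ (i, j) = 0" using ix [of i j] assms by auto
  next
    fix i j assume "i < dim_row (0\<^sub>m d d :: 'a mat)" "j < dim_col (0\<^sub>m d d :: 'a mat)"
    then show "B $$ (i, j) = 0\<^sub>m d d $$ (i, j)" using ix [of i "j + d"] assms by auto
  next
    fix i j assume "i < dim_row (0\<^sub>m d d :: 'a mat)" "j < dim_col (0\<^sub>m d d :: 'a mat)"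
    then show "C $$ (i, j) = 0\<^sub>m d d $$ (i, j)" using ix [of "i + d" j] assms by auto
  next
    fix i j assume "i < dim_row D" "j < dim_col D" "i \<noteq> j"
    then show "D $$ (i, j) = 0" using ix [of "i + d" "j + d"] assms by auto
  qed (use assms in auto)
next
  assume "diagonal_mat A \<and> B = 0\<^sub>m d d \<and> C = 0\<^sub>m d d \<and> diagonal_mat D"
  then show "diagonal_mat (four_block_mat A B C D)"
    using assms unfolding diagonal_mat_def by auto
qed

section \<open>Fixed points of the conjugation action\<close>

lemma J_0: "J n 0 = 1\<^sub>m (2 ^ n)"
proof -
  have "kron_pow (1\<^sub>m 2) m = (1\<^sub>m (2 ^ m) :: real mat)" for m
    by (induction m) (simp_all add: kron_one)
  then show ?thesis by (simp add: J_def kron_one)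
qed

text \<open>Reading \<open>k = 0\<close> as the identity lets this recursion produce all generators: those of level
  \<open>n + 1\<close> are \<open>J2 \<otimes> J n k\<close> for \<open>k\<close> from \<open>0\<close> to \<open>n\<close>.\<close>

lemma J_Suc: "J (Suc n) (Suc k) = J2 \<otimes>\<^sub>K J n k"
  by (simp add: J_def kron_assoc)

text \<open>The antidiagonal block matrix \<open>J2 \<otimes> U\<close> exchanges block rows when it multiplies from the left
  and block columns when it multiplies from the right, so opposite blocks trade places.\<close>

lemma conj_J_four_block:
  assumes J: "U \<in> carrier_mat d d" and "P \<in> carrier_mat d d" "Q \<in> carrier_mat d d"
    "R \<in> carrier_mat d d" "S \<in> carrier_mat d d"
  shows "(J2 \<otimes>\<^sub>K U) * four_block_mat P Q R S * (J2 \<otimes>\<^sub>K U)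
    = four_block_mat (U * S * U) (U * R * U) (U * Q * U) (U * P * U)"
proof -
  have Z: "0\<^sub>m d d \<in> carrier_mat d d" by simp
  have "(J2 \<otimes>\<^sub>K U) * four_block_mat P Q R S = four_block_mat (U * R) (U * S) (U * P) (U * Q)"
    unfolding kron_J2 [OF J] using assms
    by (subst mult_four_block_mat [OF Z J J Z]) auto
  moreover have "four_block_mat (U * R) (U * S) (U * P) (U * Q) * (J2 \<otimes>\<^sub>K U)
      = four_block_mat (U * S * U) (U * R * U) (U * Q * U) (U * P * U)"
    unfolding kron_J2 [OF J] using assms
    by (subst mult_four_block_mat [where ?nr1.0 = d and ?nr2.0 = d and ?n1.0 = d and ?n2.0 = d
          and ?nc1.0 = d and ?nc2.0 = d]) auto
  ultimately show ?thesis by simp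
qed

text \<open>The generator \<open>J2 \<otimes> 1\<close> makes opposite blocks equal; once they are, the generators
  \<open>J2 \<otimes> J n k\<close> with \<open>k \<ge> 1\<close> act on each block separately.\<close>

lemma Fix_Z2_Suc:
  "Fix_Z2 (Suc n) = {four_block_mat A B B A | A B. A \<in> Fix_Z2 n \<and> B \<in> Fix_Z2 n}"
proof -
  let ?d = "2 ^ n :: nat"
  have shift: "(\<forall>k\<in>{1..Suc n}. P k) \<longleftrightarrow> (\<forall>k\<in>{0..n}. P (Suc k))" for P
    by (metis One_nat_def image_Suc_atLeastAtMost ball_simps(9))
  have Jk: "J n k \<in> carrier_mat ?d ?d" if "k \<in> {0..n}" for k using that J_carrier by auto
  have fixed_blocks: "four_block_mat P Q R S \<in> Fix_Z2 (Suc n)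
      \<longleftrightarrow> R = Q \<and> S = P \<and> P \<in> Fix_Z2 n \<and> Q \<in> Fix_Z2 n"
    if c: "P \<in> carrier_mat ?d ?d" "Q \<in> carrier_mat ?d ?d" "R \<in> carrier_mat ?d ?d"
      "S \<in> carrier_mat ?d ?d" for P Q R S
  proof -
    have "four_block_mat P Q R S \<in> carrier_mat (2 ^ Suc n) (2 ^ Suc n)"
      using c by (intro carrier_matI) auto
    then have "four_block_mat P Q R S \<in> Fix_Z2 (Suc n) \<longleftrightarrow>
      (\<forall>k\<in>{0..n}. (J2 \<otimes>\<^sub>K J n k) * four_block_mat P Q R S * (J2 \<otimes>\<^sub>K J n k) = four_block_mat P Q R S)"
      unfolding Fix_Z2_eq shift by (simp add: J_Suc)
    also have "\<dots> \<longleftrightarrow> (\<forall>k\<in>{0..n}. J n k * S * J n k = P \<and> J n k * R * J n k = Q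
        \<and> J n k * Q * J n k = R \<and> J n k * P * J n k = S)"
    proof (intro ball_cong refl)
      fix k assume "k \<in> {0..n}"
      note Jk = Jk [OF this]
      have "J n k * M * J n k \<in> carrier_mat ?d ?d" if "M \<in> carrier_mat ?d ?d" for M
        using that Jk by simp
      note Jc = this [OF c(4)] this [OF c(3)] this [OF c(2)] this [OF c(1)]
      show "(J2 \<otimes>\<^sub>K J n k) * four_block_mat P Q R S * (J2 \<otimes>\<^sub>K J n k) = four_block_mat P Q R S
        \<longleftrightarrow> J n k * S * J n k = P \<and> J n k * R * J n k = Q
          \<and> J n k * Q * J n k = R \<and> J n k * P * J n k = S"
        unfolding conj_J_four_block [OF Jk c] by (rule four_block_mat_inject [OF Jc c])
    qed
    also have "\<dots> \<longleftrightarrow> R = Q \<and> S = P \<and> P \<in> Fix_Z2 n \<and> Q \<in> Fix_Z2 n"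
    proof
      assume all: "\<forall>k\<in>{0..n}. J n k * S * J n k = P \<and> J n k * R * J n k = Q
        \<and> J n k * Q * J n k = R \<and> J n k * P * J n k = S"
      then have "1\<^sub>m ?d * S * 1\<^sub>m ?d = P" "1\<^sub>m ?d * R * 1\<^sub>m ?d = Q"
        by (auto simp: J_0 dest: bspec [of _ _ 0])
      then have "S = P" "R = Q" using c by auto
      with all c show "R = Q \<and> S = P \<and> P \<in> Fix_Z2 n \<and> Q \<in> Fix_Z2 n"
        unfolding Fix_Z2_eq by auto
    next
      assume r: "R = Q \<and> S = P \<and> P \<in> Fix_Z2 n \<and> Q \<in> Fix_Z2 n"
      have "J n k * A * J n k = A" if "A \<in> Fix_Z2 n" "k \<in> {0..n}" for A k
      proof (cases "k = 0")
        case True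
        with that show ?thesis unfolding Fix_Z2_eq by (auto simp: J_0)
      next
        case False
        with that show ?thesis unfolding Fix_Z2_eq by auto
      qed
      with r show "\<forall>k\<in>{0..n}. J n k * S * J n k = P \<and> J n k * R * J n k = Q
          \<and> J n k * Q * J n k = R \<and> J n k * P * J n k = S" by blast
    qed
    finally show ?thesis .
  qed
  have carr: "Fix_Z2 m \<subseteq> carrier_mat (2 ^ m) (2 ^ m)" for m
    unfolding Fix_Z2_eq by auto
  show ?thesis
  proof (intro equalityI subsetI)
    fix A assume A: "A \<in> Fix_Z2 (Suc n)"
    then have "A \<in> carrier_mat (2 * ?d) (2 * ?d)" using carr [of "Suc n"] by auto
    then obtain P Q R S where "P \<in> carrier_mat ?d ?d" "Q \<in> carrier_mat ?d ?d"
      "R \<in> carrier_mat ?d ?d" "S \<in> carrier_mat ?d ?d" "A = four_block_mat P Q R S"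
      by (rule obtain_four_blocks)
    with A fixed_blocks show "A \<in> {four_block_mat A B B A | A B. A \<in> Fix_Z2 n \<and> B \<in> Fix_Z2 n}"
      by blast
  next
    fix M assume "M \<in> {four_block_mat A B B A | A B. A \<in> Fix_Z2 n \<and> B \<in> Fix_Z2 n}"
    then show "M \<in> Fix_Z2 (Suc n)" using fixed_blocks carr by blast
  qed
qed

text \<open>With \<open>1 \<times> 1\<close> matrices at level 0, the base case of the definition of \<open>AA\<close> is an instance of
  its recursive case, so that inductions can start at 0.\<close>

lemma AA_Suc: "AA (Suc n) = {four_block_mat A B B A | A B. A \<in> AA n \<and> B \<in> AA n}"
proof (cases n)
  case 0
  have toep: "mat_of_rows_list 2 [[a, b], [b, a]] = four_block_mat A B B A"
    if "A \<in> carrier_mat 1 1" "B \<in> carrier_mat 1 1" "A $$ (0, 0) = a" "B $$ (0, 0) = b"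
    for a b :: real and A B
    using that by (intro eq_matI) (auto simp: mat_of_rows_list_def less_Suc_eq numeral_2_eq_2)
  have "\<exists>A B. mat_of_rows_list 2 [[a, b], [b, a]] = four_block_mat A B B A
      \<and> A \<in> carrier_mat 1 1 \<and> B \<in> carrier_mat 1 1" for a b :: real
    using toep [of "mat 1 1 (\<lambda>_. a)" "mat 1 1 (\<lambda>_. b)" a b] by fastforce
  then show ?thesis using toep 0 by (auto, metis)
qed simp

lemma Fix_Z2_eq_AA: "Fix_Z2 n = AA n"
  by (induction n) (simp_all add: Fix_Z2_Suc AA_Suc, simp add: Fix_Z2_eq)

section \<open>Matrices diagonalized by the Hadamard matrix V\<close>

lemma V_carrier: "V n \<in> carrier_mat (2 ^ n) (2 ^ n)"
  using V_in_GL by (auto simp: carrier_GL)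

lemma V_square: "V n * V n = 2 ^ n \<cdot>\<^sub>m 1\<^sub>m (2 ^ n)"
proof -
  let ?W = "mat_of_rows_list 2 [[1, 1], [1, -1]] :: real mat"
  have "?W \<in> carrier_mat 2 2"
    by (rule carrier_matI) (simp_all add: mat_of_rows_list_def)
  moreover have "?W * ?W = 2 \<cdot>\<^sub>m 1\<^sub>m 2"
    by (rule eq_matI)
      (auto simp: mat_of_rows_list_def scalar_prod_def numeral_2_eq_2 less_Suc_eq)
  ultimately show ?thesis
    unfolding V_def by (rule kron_pow_square)
qed

lemma inv_V: "inv\<^bsub>GL (2 ^ n)\<^esub> (V n) = (1 / 2 ^ n) \<cdot>\<^sub>m V n"
proof -
  let ?W = "(1 / 2 ^ n) \<cdot>\<^sub>m V n"
  have "?W * V n = 1\<^sub>m (2 ^ n)" "V n * ?W = 1\<^sub>m (2 ^ n)"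
    using V_carrier [of n] V_square [of n]
      mult_smult_assoc_mat [OF V_carrier V_carrier] mult_smult_distrib [OF V_carrier V_carrier]
    by auto
  moreover from this have "?W \<in> carrier (GL (2 ^ n))"
    using V_carrier [of n] unfolding carrier_GL by auto
  ultimately show ?thesis
    using group.inv_equality [OF group_GL _ V_in_GL] by (simp add: mult_GL one_GL)
qed

lemma V_Suc: "V (Suc n) = four_block_mat (V n) (V n) (V n) (- V n)"
proof -
  let ?W = "mat_of_rows_list 2 [[1, 1], [1, -1]] :: real mat"
  have W: "?W \<in> carrier_mat 2 2"
    by (rule carrier_matI) (simp_all add: mat_of_rows_list_def)
  have "(- 1) \<cdot>\<^sub>m V n = - V n" by (rule eq_matI) auto
  moreover have "V (Suc n) = ?W \<otimes>\<^sub>K V n" by (simp add: V_def)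
  ultimately show ?thesis
    unfolding kron_2x2_four_block [OF W V_carrier] by (simp add: mat_of_rows_list_def)
qed

text \<open>The right-hand factor is \<open>V\<close> instead of its inverse, which is a scalar multiple of \<open>V\<close>: the
  scalar can be absorbed into \<open>D\<close>, and \<open>V\<close> has a simpler block form.\<close>

definition diagonalized :: "nat \<Rightarrow> real mat set" where
  "diagonalized n = {V n * D * V n | D. D \<in> carrier_mat (2 ^ n) (2 ^ n) \<and> diagonal_mat D}"

lemma diagonalizedI:
  "D \<in> carrier_mat (2 ^ n) (2 ^ n) \<Longrightarrow> diagonal_mat D \<Longrightarrow> V n * D * V n \<in> diagonalized n"
  unfolding diagonalized_def by blast

lemma V_conj_four_block:
  assumes D: "D \<in> carrier_mat (2 ^ n) (2 ^ n)" "E \<in> carrier_mat (2 ^ n) (2 ^ n)"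
  shows "V (Suc n) * four_block_mat D (0\<^sub>m (2 ^ n) (2 ^ n)) (0\<^sub>m (2 ^ n) (2 ^ n)) E * V (Suc n)
    = four_block_mat (V n * (D + E) * V n) (V n * (D - E) * V n)
        (V n * (D - E) * V n) (V n * (D + E) * V n)"
proof -
  let ?d = "2 ^ n :: nat"
  let ?Z = "0\<^sub>m ?d ?d :: real mat"
  note Vc = V_carrier [of n]
  have nV: "- V n \<in> carrier_mat ?d ?d" using Vc by simp
  have Z: "?Z \<in> carrier_mat ?d ?d" by simp
  have VD: "V n * D \<in> carrier_mat ?d ?d" "V n * E \<in> carrier_mat ?d ?d" "- (V n * E) \<in> carrier_mat ?d ?d"
    using Vc D by auto
  have "V (Suc n) * four_block_mat D ?Z ?Z E
      = four_block_mat (V n * D) (V n * E) (V n * D) (- (V n * E))"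
    unfolding V_Suc using Vc D by (subst mult_four_block_mat [OF Vc Vc Vc nV D(1) Z Z D(2)]) auto
  moreover have "four_block_mat (V n * D) (V n * E) (V n * D) (- (V n * E)) * V (Suc n)
      = four_block_mat (V n * D * V n + V n * E * V n) (V n * D * V n - V n * E * V n)
          (V n * D * V n - V n * E * V n) (V n * D * V n + V n * E * V n)"
    unfolding V_Suc using Vc VD
    by (subst mult_four_block_mat [OF VD(1,2,1,3) Vc Vc Vc nV])
      (intro cong_four_block_mat, auto intro!: eq_matI)
  moreover have "V n * (D + E) * V n = V n * D * V n + V n * E * V n"
    using Vc D VD by (simp add: mult_add_distrib_mat [OF Vc] add_mult_distrib_mat [OF VD(1,2) Vc])
  moreover have "V n * (D - E) * V n = V n * D * V n - V n * E * V n"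
    using Vc D VD
    by (simp add: mult_minus_distrib_mat [OF Vc] minus_mult_distrib_mat [OF VD(1,2) Vc])
  ultimately show ?thesis by simp
qed

text \<open>The sum and the difference of the diagonal blocks of \<open>D\<close> range over all pairs of diagonal
  matrices, since a prescribed pair \<open>F, G\<close> comes from the blocks \<open>(F + G) / 2\<close> and
  \<open>(F - G) / 2\<close>.\<close>

lemma diagonalized_Suc:
  "diagonalized (Suc n) = {four_block_mat A B B A | A B. A \<in> diagonalized n \<and> B \<in> diagonalized n}"
proof -
  let ?d = "2 ^ n :: nat"
  let ?Z = "0\<^sub>m ?d ?d :: real mat"
  show ?thesis
  proof (intro equalityI subsetI)
    fix C assume "C \<in> diagonalized (Suc n)"
    then obtain D where D: "D \<in> carrier_mat (2 * ?d) (2 * ?d)" "diagonal_mat D"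
      and C: "C = V (Suc n) * D * V (Suc n)"
      unfolding diagonalized_def by auto
    obtain P Q R S where PS: "P \<in> carrier_mat ?d ?d" "Q \<in> carrier_mat ?d ?d"
      "R \<in> carrier_mat ?d ?d" "S \<in> carrier_mat ?d ?d" "D = four_block_mat P Q R S"
      using D(1) by (rule obtain_four_blocks)
    then have diag: "diagonal_mat P" "diagonal_mat S" "Q = ?Z" "R = ?Z"
      using D(2) diagonal_four_block by blast+
    have "diagonal_mat (P + S)" "diagonal_mat (P - S)"
      using diag PS unfolding diagonal_mat_def by auto
    then have "V n * (P + S) * V n \<in> diagonalized n" "V n * (P - S) * V n \<in> diagonalized n"
      using PS(1,4) by (auto intro!: diagonalizedI minus_carrier_mat)
    moreover have "C = four_block_mat (V n * (P + S) * V n) (V n * (P - S) * V n)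
        (V n * (P - S) * V n) (V n * (P + S) * V n)"
      unfolding C PS(5) diag(3,4) by (rule V_conj_four_block [OF PS(1,4)])
    ultimately show "C \<in> {four_block_mat A B B A | A B. A \<in> diagonalized n \<and> B \<in> diagonalized n}"
      by blast
  next
    fix C assume "C \<in> {four_block_mat A B B A | A B. A \<in> diagonalized n \<and> B \<in> diagonalized n}"
    then obtain F G where C: "C = four_block_mat (V n * F * V n) (V n * G * V n) (V n * G * V n) (V n * F * V n)"
      and F: "F \<in> carrier_mat ?d ?d" "diagonal_mat F" and G: "G \<in> carrier_mat ?d ?d" "diagonal_mat G"
      unfolding diagonalized_def by blast
    define D where "D = (1 / 2) \<cdot>\<^sub>m (F + G)"
    define E where "E = (1 / 2) \<cdot>\<^sub>m (F - G)"
    have DE: "D \<in> carrier_mat ?d ?d" "E \<in> carrier_mat ?d ?d"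
      using F G by (auto simp: D_def E_def)
    have FG: "D + E = F" "D - E = G"
      using F G by (auto simp: D_def E_def field_simps)
    have "diagonal_mat D" "diagonal_mat E"
      using F G unfolding diagonal_mat_def D_def E_def by auto
    then have "diagonal_mat (four_block_mat D ?Z ?Z E)"
      using DE by (subst diagonal_four_block) auto
    moreover have "four_block_mat D ?Z ?Z E \<in> carrier_mat (2 ^ Suc n) (2 ^ Suc n)"
      using DE by (intro carrier_matI) auto
    ultimately show "C \<in> diagonalized (Suc n)"
      unfolding C V_conj_four_block [OF DE, unfolded FG, symmetric] by (intro diagonalizedI)
  qed
qed

lemma diagonalized_eq_AA: "diagonalized n = AA n"
proof (induction n)
  case 0
  have "V 0 * D * V 0 = D" "diagonal_mat D" if "D \<in> carrier_mat 1 1" for D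
    using that by (auto simp: V_def diagonal_mat_def)
  then show ?case unfolding diagonalized_def by (auto, metis)
next
  case (Suc n)
  then show ?case by (simp add: diagonalized_Suc AA_Suc)
qed

lemma diagonalized_iff:
  "C \<in> diagonalized n \<longleftrightarrow> (\<exists>D \<in> carrier_mat (2 ^ n) (2 ^ n).
     diagonal_mat D \<and> C = V n * D * inv\<^bsub>GL (2 ^ n)\<^esub> (V n))"
proof -
  let ?d = "2 ^ n :: nat"
  note Vc = V_carrier [of n]
  have scale: "V n * D * ((1 / 2 ^ n) \<cdot>\<^sub>m V n) = V n * ((1 / 2 ^ n) \<cdot>\<^sub>m D) * V n"
    if D: "D \<in> carrier_mat ?d ?d" for D
    by (simp only: mult_smult_distrib [OF Vc D] mult_smult_distrib [OF mult_carrier_mat [OF Vc D] Vc]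
        mult_smult_assoc_mat [OF mult_carrier_mat [OF Vc D] Vc])
  have diag: "c \<cdot>\<^sub>m D \<in> carrier_mat ?d ?d" "diagonal_mat (c \<cdot>\<^sub>m D)"
    if "D \<in> carrier_mat ?d ?d" "diagonal_mat D" for c :: real and D
    using that by (simp_all add: diagonal_mat_def)
  have unscale: "(1 / 2 ^ n) \<cdot>\<^sub>m (2 ^ n \<cdot>\<^sub>m D) = D" for D :: "real mat"
    by auto
  show ?thesis
    unfolding diagonalized_def inv_V
  proof (intro iffI)
    assume "C \<in> {V n * D * V n | D. D \<in> carrier_mat ?d ?d \<and> diagonal_mat D}"
    then obtain D where D: "C = V n * D * V n" "D \<in> carrier_mat ?d ?d" "diagonal_mat D" by blast
    show "\<exists>D\<in>carrier_mat ?d ?d. diagonal_mat D \<and> C = V n * D * ((1 / 2 ^ n) \<cdot>\<^sub>m V n)"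
    proof (intro bexI conjI)
      show "C = V n * (2 ^ n \<cdot>\<^sub>m D) * ((1 / 2 ^ n) \<cdot>\<^sub>m V n)"
        unfolding scale [OF diag(1) [OF D(2,3)]] unscale by (rule D(1))
    qed (use diag [OF D(2,3)] in simp_all)
  next
    assume "\<exists>D\<in>carrier_mat ?d ?d. diagonal_mat D \<and> C = V n * D * ((1 / 2 ^ n) \<cdot>\<^sub>m V n)"
    then show "C \<in> {V n * D * V n | D. D \<in> carrier_mat ?d ?d \<and> diagonal_mat D}"
      using scale diag by blast
  qed
qed

section \<open>The group as tensor products of flips\<close>

text \<open>The tensor product of the powers of \<open>J2\<close> with exponents \<open>f n, \<dots>, f 1\<close>. Only parities matter;
  integer exponents turn products into pointwise sums of exponents.\<close>

primrec flip_mat :: "nat \<Rightarrow> (nat \<Rightarrow> int) \<Rightarrow> real mat" where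
  "flip_mat 0 f = 1\<^sub>m 1"
| "flip_mat (Suc n) f = (if even (f (Suc n)) then 1\<^sub>m 2 else J2) \<otimes>\<^sub>K flip_mat n f"

lemma flip_mat_carrier: "flip_mat n f \<in> carrier_mat (2 ^ n) (2 ^ n)"
proof (induction n)
  case (Suc n)
  then show ?case using J2_square(1) by (intro carrier_matI) auto
qed simp

lemma flip_mat_cong:
  "(\<And>i. i \<in> {1..n} \<Longrightarrow> even (f i) = even (g i)) \<Longrightarrow> flip_mat n f = flip_mat n g"
  by (induction n) auto

lemma flip_mat_mult: "flip_mat n f * flip_mat n g = flip_mat n (\<lambda>i. f i + g i)"
proof (induction n)
  case (Suc n)
  show ?case
    using J2_square flip_mat_carrier [of n f] flip_mat_carrier [of n g]
    by (simp add: kron_mult Suc)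
qed simp

lemma flip_mat_even: "(\<And>i. i \<in> {1..n} \<Longrightarrow> even (f i)) \<Longrightarrow> flip_mat n f = 1\<^sub>m (2 ^ n)"
  by (induction n) (simp_all add: kron_one)

text \<open>An odd leading exponent puts zero blocks on the diagonal, where the identity matrix has ones. This
  is the independence of the tensor factors, and gives injectivity of the isomorphism.\<close>

lemma flip_mat_eq_one_iff:
  "flip_mat n f = 1\<^sub>m (2 ^ n) \<longleftrightarrow> (\<forall>i \<in> {1..n}. even (f i))"
proof (intro iffI)
  assume "flip_mat n f = 1\<^sub>m (2 ^ n)"
  then show "\<forall>i \<in> {1..n}. even (f i)"
  proof (induction n)
    case (Suc n)
    let ?d = "2 ^ n :: nat"
    note U = flip_mat_carrier [of n f]
    have one: "1\<^sub>m (2 ^ Suc n) = four_block_mat (1\<^sub>m ?d) (0\<^sub>m ?d ?d) (0\<^sub>m ?d ?d) (1\<^sub>m ?d :: real mat)"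
      by (simp add: mult_2)
    have "0\<^sub>m ?d ?d $$ (0, 0) \<noteq> (1\<^sub>m ?d :: real mat) $$ (0, 0)" by simp
    then have neq: "0\<^sub>m ?d ?d \<noteq> (1\<^sub>m ?d :: real mat)" by metis
    have even: "even (f (Suc n))"
    proof (rule ccontr)
      assume "odd (f (Suc n))"
      then have "four_block_mat (0\<^sub>m ?d ?d) (flip_mat n f) (flip_mat n f) (0\<^sub>m ?d ?d)
          = four_block_mat (1\<^sub>m ?d) (0\<^sub>m ?d ?d) (0\<^sub>m ?d ?d) (1\<^sub>m ?d)"
        using Suc.prems U unfolding one by (simp add: kron_J2)
      then show False using U neq by (subst (asm) four_block_mat_inject [where d = ?d]) auto
    qed
    then have "four_block_mat (flip_mat n f) (0\<^sub>m ?d ?d) (0\<^sub>m ?d ?d) (flip_mat n f)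
        = four_block_mat (1\<^sub>m ?d) (0\<^sub>m ?d ?d) (0\<^sub>m ?d ?d) (1\<^sub>m ?d)"
      using Suc.prems U unfolding one by (simp add: kron_id2)
    then have "flip_mat n f = 1\<^sub>m ?d"
      using U by (subst (asm) four_block_mat_inject [where d = ?d]) auto
    with even Suc.IH show ?case by (auto simp: le_Suc_eq)
  qed simp
qed (rule flip_mat_even, blast)

lemma flip_mat_square: "flip_mat n f * flip_mat n f = 1\<^sub>m (2 ^ n)"
  by (simp add: flip_mat_mult flip_mat_even)

lemma flip_mat_symmetric: "transpose_mat (flip_mat n f) = flip_mat n f"
proof (induction n)
  case (Suc n)
  have "transpose_mat J2 = J2"
    by (rule eq_matI) (auto simp: J2_def mat_of_rows_list_def numeral_2_eq_2 less_Suc_eq)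
  with Suc show ?case by (simp add: kron_transpose)
qed simp

lemma flip_mat_entries:
  "i < 2 ^ n \<Longrightarrow> j < 2 ^ n \<Longrightarrow> flip_mat n f $$ (i, j) \<in> {0, 1}"
proof (induction n arbitrary: i j)
  case (Suc n)
  note U = flip_mat_carrier [of n f]
  show ?case
    using Suc.prems Suc.IH [of i j] Suc.IH [of "i - 2 ^ n" j] Suc.IH [of i "j - 2 ^ n"]
      Suc.IH [of "i - 2 ^ n" "j - 2 ^ n"] U
    by (auto simp: kron_J2 [OF U] kron_id2 [OF U])
qed simp

text \<open>The tensor factors of \<open>flip_mat\<close> are numbered from right to left, so the leading \<open>k\<close> factors are
  those with index above \<open>n - k\<close>. Written as \<open>n < i + k\<close>, this condition is unchanged when \<open>n\<close>
  and \<open>k\<close> both grow by one, which is what the induction needs.\<close>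

lemma J_eq_flip_mat: "k \<le> n \<Longrightarrow> J n k = flip_mat n (\<lambda>i. if n < i + k then 1 else 0)"
proof (induction n arbitrary: k)
  case 0
  then show ?case by (simp add: J_0)
next
  case (Suc n)
  show ?case
  proof (cases k)
    case 0
    then show ?thesis by (simp only: J_0) (rule flip_mat_even [symmetric], simp)
  next
    case (Suc l)
    with Suc.prems Suc.IH [of l] show ?thesis by (simp add: J_Suc)
  qed
qed

lemma carrier_Z2_group_generate:
  "carrier (Z2_group n) = generate (GL (2 ^ n)) (J n ` {1..n})"
proof -
  have "J n ` {1..n} \<subseteq> carrier (GL (2 ^ n))" using J_in_GL by auto
  then show ?thesis by (simp add: Z2_group_def carrier_subgroup_generated Int_absorb1)
qed

text \<open>On a generator, \<open>1 \<otimes> J n k = (J2 \<otimes> J n 0) (J2 \<otimes> J n k)\<close> is a product of two generators of the next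
  level; both sides are multiplicative, so this extends to the generated group.\<close>

lemma kron_id2_generate:
  assumes "U \<in> generate (GL (2 ^ n)) (J n ` {1..n})"
  shows "1\<^sub>m 2 \<otimes>\<^sub>K U \<in> generate (GL (2 ^ Suc n)) (J (Suc n) ` {1..Suc n})"
proof -
  let ?H = "generate (GL (2 ^ Suc n)) (J (Suc n) ` {1..Suc n})"
  have gen: "J (Suc n) (Suc k) \<in> ?H" if "k \<le> n" for k
    using that by (intro generate.incl imageI) auto
  have mult: "U * Y \<in> ?H" if "U \<in> ?H" "Y \<in> ?H" for U Y
    using generate.eng [OF that] by (simp add: mult_GL)
  have J: "1\<^sub>m 2 \<otimes>\<^sub>K J n k \<in> ?H" if "k \<le> n" for k
  proof -
    have "J (Suc n) (Suc 0) * J (Suc n) (Suc k) = 1\<^sub>m 2 \<otimes>\<^sub>K J n k"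
      using J_carrier [OF that] J2_square by (simp add: J_Suc J_0 kron_mult)
    with mult [OF gen [of 0] gen [OF that]] show ?thesis by simp
  qed
  from assms show ?thesis
  proof induction
    case one
    then show ?case
      using generate.one [of "GL (2 ^ Suc n)"] by (simp add: one_GL kron_one)
  next
    case (incl h)
    then show ?case using J by auto
  next
    case (inv h)
    then show ?case using J inv_J by auto
  next
    case (eng g h)
    have "generate (GL (2 ^ n)) (J n ` {1..n}) \<subseteq> carrier (GL (2 ^ n))"
      using J_in_GL by (intro group.generate_incl [OF group_GL]) auto
    with eng.hyps have "g \<in> carrier_mat (2 ^ n) (2 ^ n)" "h \<in> carrier_mat (2 ^ n) (2 ^ n)"
      by (auto simp: carrier_GL)
    then have "1\<^sub>m 2 \<otimes>\<^sub>K (g * h) = (1\<^sub>m 2 \<otimes>\<^sub>K g) * (1\<^sub>m 2 \<otimes>\<^sub>K h)"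
      by (simp add: kron_mult)
    with mult [OF eng.IH] show ?case by (simp add: mult_GL)
  qed
qed

text \<open>Every tensor product of flips is generated because a leading flip can be split off:
  \<open>J2 \<otimes> U = (J2 \<otimes> 1) (1 \<otimes> U)\<close>.\<close>

lemma carrier_Z2_group: "carrier (Z2_group n) = range (flip_mat n)"
proof (intro equalityI subsetI)
  fix U assume "U \<in> carrier (Z2_group n)"
  then have "U \<in> generate (GL (2 ^ n)) (J n ` {1..n})" by (simp add: carrier_Z2_group_generate)
  then show "U \<in> range (flip_mat n)"
  proof induction
    case one
    have "1\<^sub>m (2 ^ n) = flip_mat n (\<lambda>_. 0)" by (simp add: flip_mat_even)
    then show ?case by (simp add: one_GL)
  next
    case (incl h)
    then show ?case using J_eq_flip_mat by auto
  next
    case (inv h)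
    then show ?case using J_eq_flip_mat inv_J by auto
  next
    case (eng g h)
    then show ?case by (auto simp: mult_GL flip_mat_mult)
  qed
next
  fix U assume "U \<in> range (flip_mat n)"
  then obtain f where U: "U = flip_mat n f" by blast
  have "flip_mat n f \<in> generate (GL (2 ^ n)) (J n ` {1..n})"
  proof (induction n)
    case 0
    then show ?case using generate.one [of "GL 1"] by (simp add: one_GL)
  next
    case (Suc n)
    let ?H = "generate (GL (2 ^ Suc n)) (J (Suc n) ` {1..Suc n})"
    note I = kron_id2_generate [OF Suc.IH]
    have "J (Suc n) (Suc 0) \<in> ?H" by (intro generate.incl imageI) auto
    then have "J (Suc n) (Suc 0) * (1\<^sub>m 2 \<otimes>\<^sub>K flip_mat n f) \<in> ?H"
      using generate.eng I by (fastforce simp: mult_GL)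
    moreover have "J (Suc n) (Suc 0) * (1\<^sub>m 2 \<otimes>\<^sub>K flip_mat n f) = J2 \<otimes>\<^sub>K flip_mat n f"
      using flip_mat_carrier [of n f] J2_square(1) by (simp add: J_Suc J_0 kron_mult)
    ultimately show ?case using I by simp
  qed
  then show "U \<in> carrier (Z2_group n)" by (simp add: U carrier_Z2_group_generate)
qed

lemma group_Z2_group: "group (Z2_group n)"
  unfolding Z2_group_def by (rule group.group_subgroup_generated [OF group_GL])

lemma mult_Z2_group: "x \<otimes>\<^bsub>Z2_group n\<^esub> y = x * y"
  and one_Z2_group: "\<one>\<^bsub>Z2_group n\<^esub> = 1\<^sub>m (2 ^ n)"
  by (simp_all add: Z2_group_def mult_GL one_GL)

lemma flip_mat_iso:
  "flip_mat n \<in> iso (product_group {1..n} (\<lambda>_. integer_mod_group 2)) (Z2_group n)"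
proof -
  let ?P = "product_group {1..n} (\<lambda>_. integer_mod_group 2)"
  have P: "group ?P" by simp
  have hom: "flip_mat n \<in> hom ?P (Z2_group n)"
    by (rule homI) (auto simp: carrier_Z2_group mult_Z2_group flip_mat_mult intro!: flip_mat_cong)
  then interpret group_hom ?P "Z2_group n" "flip_mat n"
    using P group_Z2_group by (simp add: group_hom_def group_hom_axioms_def)
  show ?thesis
    unfolding iso_iff
  proof (intro conjI subsetI ballI impI)
    fix U assume "U \<in> carrier (Z2_group n)"
    then obtain f where U: "U = flip_mat n f" by (auto simp: carrier_Z2_group)
    have "U = flip_mat n (\<lambda>i\<in>{1..n}. f i mod 2)"
      unfolding U by (rule flip_mat_cong) simp
    moreover have "(\<lambda>i\<in>{1..n}. f i mod 2) \<in> carrier ?P"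
      by (auto simp: carrier_integer_mod_group)
    ultimately show "U \<in> flip_mat n ` carrier ?P" by blast
  next
    fix f assume f: "f \<in> carrier ?P" and "flip_mat n f = \<one>\<^bsub>Z2_group n\<^esub>"
    then have "even (f i)" "f i \<in> {0..<2}" if "i \<in> {1..n}" for i
      using that by (auto simp: one_Z2_group flip_mat_eq_one_iff carrier_integer_mod_group PiE_iff)
    then have "f i = 0" if "i \<in> {1..n}" for i using that by force
    with f show "f = \<one>\<^bsub>?P\<^esub>"
      by (auto simp: PiE_iff extensional_def)
  qed
qed

lemma card_Z2_group: "card (carrier (Z2_group n)) = 2 ^ n"
proof -
  have "card (carrier (Z2_group n))
      = card (carrier (product_group {1..n} (\<lambda>_. integer_mod_group 2)))"
    by (rule bij_betw_same_card [symmetric, where f = "flip_mat n"])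
      (use flip_mat_iso [of n] in \<open>simp only: iso_def mem_Collect_eq\<close>)
  also have "\<dots> = 2 ^ n"
    by (simp add: card_PiE carrier_integer_mod_group)
  finally show ?thesis .
qed

section \<open>Conjugation as a group action\<close>

text \<open>Conjugation by \<open>inv g\<close> inverts conjugation by \<open>g\<close>, so each conjugation is a bijection. The whole
  general linear group acts in this way; the action of the group generated by the \<open>J n k\<close> is a
  restriction.\<close>

lemma conj_action_hom: "conj_action d \<in> hom (GL d) (BijGroup (carrier_mat d d))"
proof -
  let ?E = "carrier_mat d d :: real mat set"
  interpret G: group "GL d" by (rule group_GL)
  have carr: "g \<in> ?E" "inv\<^bsub>GL d\<^esub> g \<in> ?E" if "g \<in> carrier (GL d)" for g
    using that G.inv_closed [OF that] by (auto simp: carrier_GL)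
  have closed: "conj_action d g A \<in> ?E" if "g \<in> carrier (GL d)" "A \<in> ?E" for g A
    using carr [OF that(1)] that(2) by (auto simp: conj_action_def)
  have mult: "conj_action d (g * h) A = conj_action d g (conj_action d h A)"
    if g: "g \<in> carrier (GL d)" and h: "h \<in> carrier (GL d)" and A: "A \<in> ?E" for g h A
  proof -
    have "inv\<^bsub>GL d\<^esub> (g * h) = inv\<^bsub>GL d\<^esub> h * inv\<^bsub>GL d\<^esub> g"
      using G.inv_mult_group [OF g h] by (simp add: mult_GL)
    then show ?thesis
      using A carr [OF g] carr [OF h] closed [OF h A]
      by (simp add: conj_action_def assoc_mult_mat [of _ d d _ d _ d])
  qed
  have one: "conj_action d (1\<^sub>m d) A = A" if "A \<in> ?E" for A
    using that G.inv_one by (simp add: conj_action_def one_GL)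
  have inv: "conj_action d (inv\<^bsub>GL d\<^esub> g) (conj_action d g A) = A"
    "conj_action d g (conj_action d (inv\<^bsub>GL d\<^esub> g) A) = A"
    if g: "g \<in> carrier (GL d)" and A: "A \<in> ?E" for g A
    using mult [OF G.inv_closed [OF g] g A] mult [OF g G.inv_closed [OF g] A]
      G.l_inv [OF g] G.r_inv [OF g] one [OF A] by (simp_all add: mult_GL one_GL)
  have bij: "conj_action d g \<in> Bij ?E" if g: "g \<in> carrier (GL d)" for g
  proof -
    have "bij_betw (conj_action d g) ?E ?E"
      using inv [OF g] closed [OF g] closed [OF G.inv_closed [OF g]]
      by (intro bij_betw_byWitness [where f' = "conj_action d (inv\<^bsub>GL d\<^esub> g)"]) auto
    moreover have "conj_action d g \<in> extensional ?E"
      by (simp add: conj_action_def)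
    ultimately show ?thesis by (simp add: Bij_def)
  qed
  show ?thesis
  proof (rule homI)
    fix g assume "g \<in> carrier (GL d)"
    then show "conj_action d g \<in> carrier (BijGroup ?E)" using bij by (simp add: BijGroup_def)
  next
    fix g h assume g: "g \<in> carrier (GL d)" and h: "h \<in> carrier (GL d)"
    have "conj_action d (g * h) = compose ?E (conj_action d g) (conj_action d h)"
    proof
      fix A show "conj_action d (g * h) A = compose ?E (conj_action d g) (conj_action d h) A"
        using mult [OF g h] by (cases "A \<in> ?E") (simp_all add: compose_def conj_action_def)
    qed
    then show "conj_action d (g \<otimes>\<^bsub>GL d\<^esub> h)
        = conj_action d g \<otimes>\<^bsub>BijGroup ?E\<^esub> conj_action d h"
      using bij [OF g] bij [OF h] by (simp add: BijGroup_def mult_GL)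
  qed
qed

lemma group_action_Z2:
  "group_action (Z2_group n) (carrier_mat (2 ^ n) (2 ^ n)) (conj_action (2 ^ n))"
proof (unfold group_action_def group_hom_def group_hom_axioms_def, intro conjI)
  show "conj_action (2 ^ n) \<in> hom (Z2_group n) (BijGroup (carrier_mat (2 ^ n) (2 ^ n)))"
    unfolding Z2_group_def by (rule group.hom_from_subgroup_generated [OF group_GL conj_action_hom])
qed (rule group_Z2_group group_BijGroup)+

section \<open>Symmetries of the lattice\<close>

lemma flip_mat_commute:
  assumes A: "A \<in> Fix_Z2 n"
  shows "flip_mat n f * A = A * flip_mat n f"
proof -
  let ?d = "2 ^ n :: nat"
  let ?F = "flip_mat n f"
  note U = flip_mat_carrier [of n f]
  have Ac: "A \<in> carrier_mat ?d ?d" using A by (simp add: Fix_Z2_eq)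
  have "?F \<in> carrier (Z2_group n)" by (simp add: carrier_Z2_group)
  then have "?F * A * inv\<^bsub>GL ?d\<^esub> ?F = A"
    using A by (auto simp: Fix_Z2_def fixed_points_def conj_action_def)
  moreover have "inv\<^bsub>GL ?d\<^esub> ?F = ?F"
    using U flip_mat_square [of n f]
    by (intro group.inv_equality [OF group_GL]) (auto simp: mult_GL one_GL carrier_GL)
  ultimately have "?F * A * ?F * ?F = A * ?F" by simp
  moreover have "?F * A * ?F * ?F = ?F * A"
    using U Ac flip_mat_square [of n f] by (simp add: assoc_mult_mat [of _ ?d ?d _ ?d _ ?d])
  ultimately show ?thesis by simp
qed

text \<open>Since \<open>P = flip_mat n f\<close> commutes with \<open>A\<close> and has integer entries, \<open>P\<close> maps the lattice into
  itself; being an involution, it maps onto.\<close>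

lemma flip_mat_symmetry:
  assumes A: "A \<in> Fix_Z2 n" and ne: "flip_mat n f \<noteq> 1\<^sub>m (2 ^ n)"
  shows "flip_mat n f \<in> symmetries (2 ^ n) (lattice_of (2 ^ n) A)"
proof -
  let ?d = "2 ^ n :: nat"
  let ?F = "flip_mat n f"
  let ?L = "lattice_of ?d A"
  note U = flip_mat_carrier [of n f]
  have Ac: "A \<in> carrier_mat ?d ?d" using A by (simp add: Fix_Z2_eq)
  have into: "?F *\<^sub>v x \<in> ?L" if "x \<in> ?L" for x
  proof -
    from that obtain z where z: "z \<in> carrier_vec ?d" "\<forall>i<?d. z $ i \<in> \<int>" and x: "x = A *\<^sub>v z"
      unfolding lattice_of_def by blast
    have "(?F *\<^sub>v z) $ i \<in> \<int>" if "i < ?d" for i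
    proof -
      have "?F $$ (i, j) * z $ j \<in> \<int>" if "j < ?d" for j
        using flip_mat_entries [OF \<open>i < ?d\<close> that, of f] z(2) that by auto
      then show ?thesis using U z(1) that by (auto simp: scalar_prod_def intro!: Ints_sum)
    qed
    moreover have "?F *\<^sub>v x = A *\<^sub>v (?F *\<^sub>v z)"
      unfolding x using U Ac z(1) flip_mat_commute [OF A, of f]
      by (metis assoc_mult_mat_vec)
    moreover have "?F *\<^sub>v z \<in> carrier_vec ?d" using U z(1) by simp
    ultimately show ?thesis unfolding lattice_of_def by blast
  qed
  have invol: "?F *\<^sub>v (?F *\<^sub>v x) = x" if "x \<in> ?L" for x
  proof -
    have "x \<in> carrier_vec ?d" using that Ac by (auto simp: lattice_of_def)
    then show ?thesis using U flip_mat_square [of n f] by (metis assoc_mult_mat_vec one_mult_mat_vec)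
  qed
  have "(\<lambda>x. ?F *\<^sub>v x) ` ?L = ?L"
  proof (intro equalityI subsetI)
    fix x assume x: "x \<in> ?L"
    show "x \<in> (\<lambda>x. ?F *\<^sub>v x) ` ?L"
      using invol [OF x] into [OF x] by (metis imageI)
  qed (use into in auto)
  \<comment> \<open>The entries of a flip are nonnegative, those on the diagonal of \<open>-1\<close> are not.\<close>
  moreover have "?F \<noteq> - 1\<^sub>m ?d"
  proof
    assume "?F = - 1\<^sub>m ?d"
    then have "?F $$ (0, 0) = -1" by simp
    then show False using flip_mat_entries [of 0 n 0 f] by auto
  qed
  ultimately show ?thesis
    using U ne flip_mat_square [of n f] flip_mat_symmetric [of n f] by (simp add: symmetries_def)
qed

theorem theorem2p2:
  fixes n :: nat
  assumes "n \<ge> 1"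
  shows "Z2_group n \<cong> product_group {1..n} (\<lambda>_. integer_mod_group 2)
    \<and> group_action (Z2_group n) (carrier_mat (2 ^ n) (2 ^ n)) (conj_action (2 ^ n))
    \<and> Fix_Z2 n = AA n
    \<and> (\<forall>C \<in> carrier_mat (2 ^ n) (2 ^ n).
        C \<in> Fix_Z2 n \<longleftrightarrow>
        (\<exists>D \<in> carrier_mat (2 ^ n) (2 ^ n).
          diagonal_mat D \<and> C = V n * D * inv\<^bsub>GL (2 ^ n)\<^esub> (V n)))
    \<and> (\<forall>A \<in> Fix_Z2 n \<inter> carrier (GL (2 ^ n)).
        \<exists>S \<subseteq> symmetries (2 ^ n) (lattice_of (2 ^ n) A). finite S \<and> card S \<ge> 2 ^ n - 1)"
proof (intro conjI ballI)
  have "product_group {1..n} (\<lambda>_. integer_mod_group 2) \<cong> Z2_group n"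
    using flip_mat_iso by (auto simp: is_iso_def)
  then show "Z2_group n \<cong> product_group {1..n} (\<lambda>_. integer_mod_group 2)"
    by (rule group.iso_sym [rotated]) simp
next
  show "group_action (Z2_group n) (carrier_mat (2 ^ n) (2 ^ n)) (conj_action (2 ^ n))"
    by (rule group_action_Z2)
next
  show "Fix_Z2 n = AA n" by (rule Fix_Z2_eq_AA)
next
  fix C
  show "C \<in> Fix_Z2 n \<longleftrightarrow> (\<exists>D \<in> carrier_mat (2 ^ n) (2 ^ n).
      diagonal_mat D \<and> C = V n * D * inv\<^bsub>GL (2 ^ n)\<^esub> (V n))"
    unfolding diagonalized_iff [symmetric] by (simp add: Fix_Z2_eq_AA diagonalized_eq_AA)
next
  fix A assume A: "A \<in> Fix_Z2 n \<inter> carrier (GL (2 ^ n))"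
  let ?S = "carrier (Z2_group n) - {1\<^sub>m (2 ^ n)}"
  have fin: "finite (carrier (Z2_group n))"
    by (rule card_ge_0_finite) (simp add: card_Z2_group)
  have "?S \<subseteq> symmetries (2 ^ n) (lattice_of (2 ^ n) A)"
    using A flip_mat_symmetry by (auto simp: carrier_Z2_group)
  moreover have "card ?S \<ge> 2 ^ n - 1"
    using diff_card_le_card_Diff [of "{1\<^sub>m (2 ^ n)}" "carrier (Z2_group n)"] card_Z2_group [of n] by simp
  ultimately show "\<exists>S \<subseteq> symmetries (2 ^ n) (lattice_of (2 ^ n) A). finite S \<and> card S \<ge> 2 ^ n - 1"
    using fin by blast
qed

end
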